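(* The function $d_1^{\mathrm{dynG}}$ (the interleaving distance between dynamic graphs) is an extended pseudo-metric on the collection of dynamic Bayesian graphs. That is, for all dynamic Bayesian graphs $\mathscr{G}_{\mathcal{X}},\mathscr{G}_{\mathcal{Y}},\mathscr{G}_{\mathcal{W}}$ one has $d_1^{\mathrm{dynG}}(\mathscr{G}_{\mathcal{X}},\mathscr{G}_{\mathcal{Y}})\in[0,\infty]$, $d_1^{\mathrm{dynG}}(\mathscr{G}_{\mathcal{X}},\mathscr{G}_{\mathcal{X}})=0$, $d_1^{\mathrm{dynG}}(\mathscr{G}_{\mathcal{X}},\mathscr{G}_{\mathcal{Y}})=d_1^{\mathrm{dynG}}(\mathscr{G}_{\mathcal{Y}},\mathscr{G}_{\mathcal{X}})$, and $d_1^{\mathrm{dynG}}(\mathscr{G}_{\mathcal{X}},\mathscr{G}_{\mathcal{W}})\le d_1^{\mathrm{dynG}}(\mathscr{G}_{\mathcal{X}},\mathscr{G}_{\mathcal{Y}})+d_1^{\mathrm{dynG}}(\mathscr{G}_{\mathcal{Y}},\mathscr{G}_{\mathcal{W}})$.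
   Context: **Dynamic graph.** Let $X$ be a finite non-empty set. A dynamic graph (DG) over $X$, written $\mathscr{G}_X$, is a pair of maps $(V_X(\cdot),E_X(\cdot))$ assigning to each $t\in\mathbb{R}$ a set $V_X(t)\subseteq X$ and a set $E_X(t)$ of unordered pairs $\{x,x'\}$ of elements of $V_X(t)$ ($x=x'$ allowed), such that, with $\mathrm{crit}$ denoting the set of $t\in\mathbb{R}$ at which $V_X(\cdot)$ or $E_X(\cdot)$ fails to be locally constant: (i) (self-loops) if $x\in V_X(t)$ then $\{x,x\}\in E_X(t)$; (ii) (tameness) $\mathrm{crit}$ is locally finite (every bounded interval contains finitely many of its points); (iii) (lifespan) for every $x\in X$, the set $I_x=\{t\in\mathbb{R}: x\in V_X(t)\}$ is a non-empty closed interval; (iv) (comparability) for every $t\in\mathbb{R}$ and all sufficiently small $\varepsilon>0$, $V_X(t-\varepsilon)\subseteq V_X(t)\supseteq V_X(t+\varepsilon)$ and $E_X(t-\varepsilon)\subseteq E_X(t)\supseteq E_X(t+\varepsilon)$. **Dynamic Bayesian network (DBN).** There is a finite non-empty set $\mathcal{X}$ of random variables, each with a finite state space, and a copy $\mathcal{X}^{(k)}=\{X^{(k)}:X\in\mathcal{X}\}$ for each time slice $k=0,1,2,\dots$, representing the state of the system at time $k\Delta t$, where $\Delta t>0$ is fixed. The intra-slice directed edges form a fixed directed acyclic graph $G$ on $\mathcal{X}$, the same for every slice; there may also be inter-slice edges from slice $k-1$ to slice $k$. Each $X^{(k)}$ has a conditional probability table (CPT) giving its distribution conditional on each joint configuration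 of its parents; CPTs may vary with $k$. **Edge strength.** For probability mass functions $p,p'$ on the same finite set $S$, $d_V(p,p')=\frac12\sum_{x\in S}|p(x)-p'(x)|$. For a stochastic matrix $P$ with rows $p_1,\dots,p_n$, the upper diameter is $d^+(P)=\max_{i\ne j}d_V(p_i,p_j)$ (equal to $0$ if $n=1$). For a directed edge $Y\to X$ of $G$ and slice $k$, the edge strength is $\delta^{(k)}_{YX}=\max_{\mathbf{x}}d^+(P^{(k)}_{X|\mathbf{x}})$, where $\mathbf{x}$ ranges over joint configurations of the parents of $X^{(k)}$ other than $Y^{(k)}$, and $P^{(k)}_{X|\mathbf{x}}$ is the sub-table of the CPT of $X^{(k)}$ consisting of the rows (indexed by the states of $Y^{(k)}$) in which the other parents have configuration $\mathbf{x}$. **Dynamic Bayesian graph (DBG).** Given a threshold $\eta\in\mathbb{R}$, for each $k\ge0$ let $E^{[k]}$ be the set of all self-loops $\{X,X\}$, $X\in\mathcal{X}$, together with all undirected pairs $\{Y,X\}$ such that $Y\to X$ is an edge of $G$ and $\delta^{(k)}_{YX}>\eta$. The variable $X^{(k)}$ is identified with the node $X$ for all $k$. The DBG $\mathscr{G}_{\mathcal{X}}=(\mathcal{X}_{\to}^{(\cdot)},E_\eta(\cdot))$ has vertex set $\mathcal{X}_{\to}^{(t)}=\mathcal{X}$ for all $t\in\mathbb{R}_+=[0,\infty)$, and edge sets $E_\eta(t)=E^{[k]}$ for $k\Delta t<t<(k+1)\Delta t$, $k\ge 0$; $E_\eta(k\Delta t)=E^{[k-1]}\cup E^{[k]}$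 for $k\ge1$ (maximum convention at transition times); $E_\eta(0)=E^{[0]}$. For $t<0$ the vertex and edge sets are empty. Every DBG is a DG. Different DBGs may come from different DBNs (different variable sets, $\Delta t$, $\eta$). **Smoothing.** For $\varepsilon\ge0$ and $t\in\mathbb{R}$, let $[t]^\varepsilon=[t-\varepsilon,t+\varepsilon]$. The $\varepsilon$-smoothing of a DG $\mathscr{G}_X$ is $S_\varepsilon\mathscr{G}_X(t)=\bigl(\bigcup_{s\in[t]^\varepsilon}V_X(s),\bigcup_{s\in[t]^\varepsilon}E_X(s)\bigr)$; it is again a DG. **Interleaving distance.** A tripod $R$ between sets $X$ and $Y$ is a set $Z$ with surjections $X\xleftarrow{\varphi_X}Z\xrightarrow{\varphi_Y}Y$. For a map $\varphi:Z\to X$, the pullback $\varphi^*\mathscr{G}_X$ has at time $t$ vertex set $\varphi^{-1}(V_X(t))$ and edges $\{z,z'\}$ with $\{\varphi(z),\varphi(z')\}\in E_X(t)$. Write $\mathscr{G}_X\xrightarrow{R}\mathscr{G}_Y$ if for every $t\in\mathbb{R}$ the graph $(\varphi_X^*\mathscr{G}_X)(t)$ is a subgraph of $(\varphi_Y^*\mathscr{G}_Y)(t)$. For the reverse direction, $\mathscr{G}_Y\xrightarrow{R}\mathscr{G}_X$ means that $(\varphi_Y^*\mathscr{G}_Y)(t)$ is a subgraph of $(\varphi_X^*\mathscr{G}_X)(t)$ for every $t$. An $\varepsilon$-tripod between DGs $\mathscr{G}_X$ and $\mathscr{G}_Y$ is a tripod $R$ between $X$ and $Y$ with $\mathscr{G}_X\xrightarrow{R}S_\varepsilon\mathscr{G}_Y$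 and $\mathscr{G}_Y\xrightarrow{R}S_\varepsilon\mathscr{G}_X$. The interleaving distance $d_1^{\mathrm{dynG}}(\mathscr{G}_X,\mathscr{G}_Y)$ is the infimum of all $\varepsilon\ge0$ for which an $\varepsilon$-tripod exists, and $+\infty$ if none exists. *)

theory Defs
  imports "HOL-Probability.Probability_Mass_Function"
begin

section \<open>Dynamic graphs\<close>

text \<open>Undirected edges are sets \<open>{x, x'}\<close>, so a self-loop at \<open>x\<close> is the singleton \<open>{x, x} = {x}\<close>.\<close>

record 'a dyn_graph =
  nodes :: "'a set"
  verts :: "real \<Rightarrow> 'a set"
  edges :: "real \<Rightarrow> 'a set set"

definition crit :: "'a dyn_graph \<Rightarrow> real set" where
  "crit G = {t. \<not> ((\<forall>\<^sub>F s in nhds t. verts G s = verts G t)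
                 \<and> (\<forall>\<^sub>F s in nhds t. edges G s = edges G t))}"

definition lifespan :: "'a dyn_graph \<Rightarrow> 'a \<Rightarrow> real set" where
  "lifespan G x = {t. x \<in> verts G t}"

definition dynamic_graph :: "'a dyn_graph \<Rightarrow> bool" where
  "dynamic_graph G \<longleftrightarrow>
     finite (nodes G) \<and> nodes G \<noteq> {} \<and>
     (\<forall>t. verts G t \<subseteq> nodes G) \<and>
     (\<forall>t. edges G t \<subseteq> {{x, x'} | x x'. x \<in> verts G t \<and> x' \<in> verts G t}) \<and>
     (\<forall>t. \<forall>x\<in>verts G t. {x, x} \<in> edges G t) \<and>
     (\<forall>a b. finite (crit G \<inter> {a..b})) \<and>
     (\<forall>x\<in>nodes G. lifespan G x \<noteq> {} \<and> closed (lifespan G x) \<and> is_interval (lifespan G x)) \<and>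
     (\<forall>t. \<forall>\<^sub>F \<epsilon> in at_right 0.
        verts G (t - \<epsilon>) \<subseteq> verts G t \<and> verts G (t + \<epsilon>) \<subseteq> verts G t \<and>
        edges G (t - \<epsilon>) \<subseteq> edges G t \<and> edges G (t + \<epsilon>) \<subseteq> edges G t)"

definition smoothing :: "real \<Rightarrow> 'a dyn_graph \<Rightarrow> 'a dyn_graph" where
  "smoothing \<epsilon> G = \<lparr> nodes = nodes G,
     verts = (\<lambda>t. \<Union>s\<in>{t - \<epsilon>..t + \<epsilon>}. verts G s),
     edges = (\<lambda>t. \<Union>s\<in>{t - \<epsilon>..t + \<epsilon>}. edges G s) \<rparr>"

definition pullback :: "'z set \<Rightarrow> ('z \<Rightarrow> 'a) \<Rightarrow> 'a dyn_graph \<Rightarrow> 'z dyn_graph" where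
  "pullback Z \<phi> G = \<lparr> nodes = Z,
     verts = (\<lambda>t. {z \<in> Z. \<phi> z \<in> verts G t}),
     edges = (\<lambda>t. {{z, z'} | z z'. z \<in> Z \<and> z' \<in> Z \<and> {\<phi> z, \<phi> z'} \<in> edges G t}) \<rparr>"

definition subgraph_always :: "'a dyn_graph \<Rightarrow> 'a dyn_graph \<Rightarrow> bool" where
  "subgraph_always G H \<longleftrightarrow> (\<forall>t. verts G t \<subseteq> verts H t \<and> edges G t \<subseteq> edges H t)"


section \<open>The interleaving distance\<close>

definition tripod :: "'z set \<Rightarrow> ('z \<Rightarrow> 'a) \<Rightarrow> ('z \<Rightarrow> 'b) \<Rightarrow> 'a set \<Rightarrow> 'b set \<Rightarrow> bool" where
  "tripod Z \<phi> \<psi> X Y \<longleftrightarrow> \<phi> ` Z = X \<and> \<psi> ` Z = Y"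

definition eps_tripod ::
    "real \<Rightarrow> 'z set \<Rightarrow> ('z \<Rightarrow> 'a) \<Rightarrow> ('z \<Rightarrow> 'b) \<Rightarrow> 'a dyn_graph \<Rightarrow> 'b dyn_graph \<Rightarrow> bool" where
  "eps_tripod \<epsilon> Z \<phi> \<psi> G H \<longleftrightarrow>
     tripod Z \<phi> \<psi> (nodes G) (nodes H) \<and>
     subgraph_always (pullback Z \<phi> G) (pullback Z \<psi> (smoothing \<epsilon> H)) \<and>
     subgraph_always (pullback Z \<psi> H) (pullback Z \<phi> (smoothing \<epsilon> G))"

text \<open>
  HOL cannot quantify existentially over the type that contains the apex \<open>Z\<close> of a tripod.
  In the distance \<open>Z\<close> is an arbitrary subset of the type \<open>'a \<times> 'b\<close>, with arbitrary surjections;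
  lemma \<open>eps_tripod_any_type\<close> below shows that an \<open>\<epsilon>\<close>-tripod with apex in any other type
  gives one with apex in this type, so the infimum is over the same set of reals.
  The infimum of the empty set in \<open>ereal\<close> is \<open>\<infinity>\<close>.
\<close>

definition interleaving_dist :: "'a dyn_graph \<Rightarrow> 'b dyn_graph \<Rightarrow> ereal" where
  "interleaving_dist G H =
     Inf {ereal \<epsilon> | \<epsilon>. \<epsilon> \<ge> 0 \<and>
       (\<exists>(Z :: ('a \<times> 'b) set) \<phi> \<psi>. eps_tripod \<epsilon> Z \<phi> \<psi> G H)}"

lemma pullback_edge_iff:
  assumes "z \<in> Z" "z' \<in> Z"
  shows "{z, z'} \<in> edges (pullback Z \<phi> G) t \<longleftrightarrow> {\<phi> z, \<phi> z'} \<in> edges G t"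
proof
  assume "{z, z'} \<in> edges (pullback Z \<phi> G) t"
  then obtain w w' where w: "{z, z'} = {w, w'}" "{\<phi> w, \<phi> w'} \<in> edges G t"
    unfolding pullback_def dyn_graph.select_convs mem_Collect_eq by blast
  have "\<phi> ` {z, z'} = \<phi> ` {w, w'}" using w(1) by (rule arg_cong)
  then have "{\<phi> z, \<phi> z'} = {\<phi> w, \<phi> w'}" by (simp only: image_insert image_empty)
  then show "{\<phi> z, \<phi> z'} \<in> edges G t" using w(2) by (simp only:)
next
  assume "{\<phi> z, \<phi> z'} \<in> edges G t"
  then show "{z, z'} \<in> edges (pullback Z \<phi> G) t" 
    using assms by (simp add: pullback_def) blast
qed

lemma subgraph_always_pullback_iff:
  "subgraph_always (pullback Z \<phi> G) (pullback Z \<psi> H) \<longleftrightarrow>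
     (\<forall>t. (\<forall>z\<in>Z. \<phi> z \<in> verts G t \<longrightarrow> \<psi> z \<in> verts H t) \<and>
          (\<forall>z\<in>Z. \<forall>z'\<in>Z. {\<phi> z, \<phi> z'} \<in> edges G t \<longrightarrow> {\<psi> z, \<psi> z'} \<in> edges H t))"
  (is "?L \<longleftrightarrow> ?R")
proof
  assume L: ?L
  show ?R
  proof (intro allI conjI ballI impI)
    fix t z assume "z \<in> Z" "\<phi> z \<in> verts G t"
    moreover have "verts (pullback Z \<phi> G) t \<subseteq> verts (pullback Z \<psi> H) t"
      using L by (simp only: subgraph_always_def)
    ultimately show "\<psi> z \<in> verts H t" unfolding pullback_def by auto
  next
    fix t z z' assume z: "z \<in> Z" "z' \<in> Z" and "{\<phi> z, \<phi> z'} \<in> edges G t"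
    then have "{z, z'} \<in> edges (pullback Z \<phi> G) t" by (simp only: pullback_edge_iff[OF z])
    moreover have "edges (pullback Z \<phi> G) t \<subseteq> edges (pullback Z \<psi> H) t"
      using L by (simp only: subgraph_always_def)
    ultimately have "{z, z'} \<in> edges (pullback Z \<psi> H) t" by (rule rev_subsetD)
    then show "{\<psi> z, \<psi> z'} \<in> edges H t" by (simp only: pullback_edge_iff[OF z])
  qed
next
  assume R: ?R
  show ?L unfolding subgraph_always_def
  proof (intro allI conjI subsetI)
    fix t z assume "z \<in> verts (pullback Z \<phi> G) t"
    then show "z \<in> verts (pullback Z \<psi> H) t" using R by (simp add: pullback_def)
  next
    fix t e assume "e \<in> edges (pullback Z \<phi> G) t"
    then obtain z z' where e: "e = {z, z'}" and z: "z \<in> Z" "z' \<in> Z" "{\<phi> z, \<phi> z'} \<in> edges G t"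
      unfolding pullback_def dyn_graph.select_convs mem_Collect_eq by blast
    have "{\<psi> z, \<psi> z'} \<in> edges H t" using R z by blast
    then show "e \<in> edges (pullback Z \<psi> H) t"
      by (simp only: e pullback_edge_iff[OF z(1,2)])
  qed
qed

lemma eps_tripod_any_type:
  fixes Z :: "'z set" and G :: "'a dyn_graph" and H :: "'b dyn_graph"
  assumes "eps_tripod \<epsilon> Z \<phi> \<psi> G H"
  shows "\<exists>(Z' :: ('a \<times> 'b) set) \<phi>' \<psi>'. eps_tripod \<epsilon> Z' \<phi>' \<psi>' G H"
proof -
  have "eps_tripod \<epsilon> ((\<lambda>z. (\<phi> z, \<psi> z)) ` Z) fst snd G H"
    using assms unfolding eps_tripod_def subgraph_always_pullback_iff
    by (simp add: tripod_def image_image)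
  then show ?thesis by blast
qed


section \<open>Dynamic Bayesian networks\<close>

text \<open>
  The copy \<open>X\<^bsup>(k)\<^esup>\<close> of a variable in slice \<open>k\<close> is the pair \<open>(X, k)\<close>. The relation \<open>inter D k\<close> consists
  of the pairs \<open>(Y, X)\<close> with an edge from \<open>(Y, k - 1)\<close> to \<open>(X, k)\<close>; slice \<open>0\<close> has no predecessor, so
  \<open>inter D 0\<close> plays no role. All state spaces are subsets of one type \<open>'s\<close>, and
  \<open>cpt D k X c\<close> is the row of the conditional probability table of \<open>(X, k)\<close> for the
  configuration \<open>c\<close> of its parents.
\<close>

record ('a, 's) dbn =
  vars :: "'a set"
  states :: "'a \<Rightarrow> 's set"
  time_step :: real
  intra :: "('a \<times> 'a) set"
  inter :: "nat \<Rightarrow> ('a \<times> 'a) set"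
  cpt :: "nat \<Rightarrow> 'a \<Rightarrow> ('a \<times> nat \<Rightarrow> 's) \<Rightarrow> 's pmf"

definition parents :: "('a, 's) dbn \<Rightarrow> nat \<Rightarrow> 'a \<Rightarrow> ('a \<times> nat) set" where
  "parents D k X =
     {(Y, k) | Y. (Y, X) \<in> intra D} \<union> {(Y, j) | Y j. Suc j = k \<and> (Y, X) \<in> inter D k}"

definition configs :: "('a, 's) dbn \<Rightarrow> ('a \<times> nat) set \<Rightarrow> ('a \<times> nat \<Rightarrow> 's) set" where
  "configs D A = (\<Pi>\<^sub>E (Y, j)\<in>A. states D Y)"

definition dynamic_bayesian_network :: "('a, 's) dbn \<Rightarrow> bool" where
  "dynamic_bayesian_network D \<longleftrightarrow>
     finite (vars D) \<and> vars D \<noteq> {} \<and>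
     (\<forall>X\<in>vars D. finite (states D X) \<and> states D X \<noteq> {}) \<and>
     time_step D > 0 \<and>
     intra D \<subseteq> vars D \<times> vars D \<and> acyclic (intra D) \<and>
     (\<forall>k. inter D k \<subseteq> vars D \<times> vars D) \<and>
     (\<forall>k. \<forall>X\<in>vars D. \<forall>c\<in>configs D (parents D k X). set_pmf (cpt D k X c) \<subseteq> states D X)"

definition d_V :: "'s set \<Rightarrow> 's pmf \<Rightarrow> 's pmf \<Rightarrow> real" where
  "d_V S p p' = 1 / 2 * (\<Sum>x\<in>S. \<bar>pmf p x - pmf p' x\<bar>)"

text \<open>The stochastic matrix \<open>P\<close> has rows indexed by \<open>I\<close> and columns indexed by \<open>S\<close>.\<close>

definition upper_diameter :: "'i set \<Rightarrow> 's set \<Rightarrow> ('i \<Rightarrow> 's pmf) \<Rightarrow> real" where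
  "upper_diameter I S P =
     (if card I = 1 then 0
      else Max {d_V S (P i) (P j) | i j. i \<in> I \<and> j \<in> I \<and> i \<noteq> j})"

definition edge_strength :: "('a, 's) dbn \<Rightarrow> nat \<Rightarrow> 'a \<Rightarrow> 'a \<Rightarrow> real" where
  "edge_strength D k Y X =
     Max ((\<lambda>x. upper_diameter (states D Y) (states D X) (\<lambda>y. cpt D k X (x((Y, k) := y))))
            ` configs D (parents D k X - {(Y, k)}))"


section \<open>Dynamic Bayesian graphs\<close>

definition slice_edges :: "('a, 's) dbn \<Rightarrow> real \<Rightarrow> nat \<Rightarrow> 'a set set" where
  "slice_edges D \<eta> k =
     {{X, X} | X. X \<in> vars D} \<union> {{Y, X} | Y X. (Y, X) \<in> intra D \<and> edge_strength D k Y X > \<eta>}"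

text \<open>Here \<open>k\<close> is the index of the slice with \<open>k \<Delta>t \<le> t < (k + 1) \<Delta>t\<close>; see lemma \<open>dbg_edges\<close>.\<close>

definition dbg :: "('a, 's) dbn \<Rightarrow> real \<Rightarrow> 'a dyn_graph" where
  "dbg D \<eta> = \<lparr> nodes = vars D,
     verts = (\<lambda>t. if t < 0 then {} else vars D),
     edges = (\<lambda>t. let k = nat \<lfloor>t / time_step D\<rfloor> in
       if t < 0 then {}
       else if k \<ge> 1 \<and> t = real k * time_step D then slice_edges D \<eta> (k - 1) \<union> slice_edges D \<eta> k
       else slice_edges D \<eta> k) \<rparr>"

lemma dbg_edges:
  assumes "time_step D > 0"
  shows "\<And>k t. \<lbrakk>real k * time_step D < t; t < (real k + 1) * time_step D\<rbrakk>
           \<Longrightarrow> edges (dbg D \<eta>) t = slice_edges D \<eta> k"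
    and "\<And>k. k \<ge> 1 \<Longrightarrow> edges (dbg D \<eta>) (real k * time_step D)
           = slice_edges D \<eta> (k - 1) \<union> slice_edges D \<eta> k"
    and "edges (dbg D \<eta>) 0 = slice_edges D \<eta> 0"
    and "\<And>t. t < 0 \<Longrightarrow> edges (dbg D \<eta>) t = {}"
proof -
  fix k :: nat and t :: real
  assume t: "real k * time_step D < t" "t < (real k + 1) * time_step D"
  have "real k * time_step D \<ge> 0" using assms by simp
  then have "t > 0" using t by linarith
  moreover have "\<lfloor>t / time_step D\<rfloor> = int k"
    using t assms by (simp add: floor_eq_iff field_simps)
  ultimately show "edges (dbg D \<eta>) t = slice_edges D \<eta> k"
    using t by (simp add: dbg_def)
next
  fix k :: nat assume "k \<ge> 1"
  moreover have "\<not> real k * time_step D < 0" using assms by (simp add: not_less)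
  ultimately show "edges (dbg D \<eta>) (real k * time_step D)
           = slice_edges D \<eta> (k - 1) \<union> slice_edges D \<eta> k"
    using assms by (simp add: dbg_def)
qed (simp_all add: dbg_def)

lemma dbg_local_const:
  assumes "time_step D > 0" and "t \<notin> range (\<lambda>k. real k * time_step D)"
  shows "\<exists>d>0. \<forall>s. \<bar>s - t\<bar> < d \<longrightarrow>
           verts (dbg D \<eta>) s = verts (dbg D \<eta>) t \<and> edges (dbg D \<eta>) s = edges (dbg D \<eta>) t"
proof (cases "t < 0")
  case True
  show ?thesis
  proof (intro exI[of _ "- t"] conjI allI impI)
    fix s assume "\<bar>s - t\<bar> < - t"
    then have "s < 0" by linarith
    then show "verts (dbg D \<eta>) s = verts (dbg D \<eta>) t" "edges (dbg D \<eta>) s = edges (dbg D \<eta>) t"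
      using True by (simp_all add: dbg_def)
  qed (use True in simp)
next
  case False
  define k where "k = nat \<lfloor>t / time_step D\<rfloor>"
  have k: "real k = of_int \<lfloor>t / time_step D\<rfloor>" using False assms(1) by (simp add: k_def)
  have "real k * time_step D \<le> t" "t < (real k + 1) * time_step D"
    using assms(1) unfolding k by (simp_all flip: pos_le_divide_eq pos_divide_less_eq)
  moreover have "real k * time_step D \<noteq> t" using assms(2) by blast
  ultimately have t: "real k * time_step D < t" "t < (real k + 1) * time_step D" by auto
  have k0: "real k * time_step D \<ge> 0" using assms(1) by simp
  show ?thesis
  proof (intro exI[of _ "min (t - real k * time_step D) ((real k + 1) * time_step D - t)"]
      conjI allI impI)
    fix s
    assume "\<bar>s - t\<bar> < min (t - real k * time_step D) ((real k + 1) * time_step D - t)"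
    then have s: "real k * time_step D < s" "s < (real k + 1) * time_step D" by linarith+
    show "edges (dbg D \<eta>) s = edges (dbg D \<eta>) t"
      using dbg_edges(1)[OF assms(1) s] dbg_edges(1)[OF assms(1) t] by simp
    have "\<not> s < 0" "\<not> t < 0" using s t k0 by linarith+
    then show "verts (dbg D \<eta>) s = verts (dbg D \<eta>) t" by (simp add: dbg_def)
  qed (use t in simp)
qed

lemma dbg_crit:
  assumes "time_step D > 0"
  shows "crit (dbg D \<eta>) \<subseteq> range (\<lambda>k. real k * time_step D)"
proof
  fix t assume t: "t \<in> crit (dbg D \<eta>)"
  show "t \<in> range (\<lambda>k. real k * time_step D)"
  proof (rule ccontr)
    assume "t \<notin> range (\<lambda>k. real k * time_step D)"
    then obtain d where "d > 0" and d: "\<And>s. \<bar>s - t\<bar> < d \<Longrightarrow>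
        verts (dbg D \<eta>) s = verts (dbg D \<eta>) t \<and> edges (dbg D \<eta>) s = edges (dbg D \<eta>) t"
      using dbg_local_const[OF assms, of t \<eta>] by blast
    have ball: "\<forall>\<^sub>F s in nhds t. \<bar>s - t\<bar> < d"
      unfolding eventually_nhds_metric dist_real_def using \<open>d > 0\<close> by blast
    have "\<forall>\<^sub>F s in nhds t. verts (dbg D \<eta>) s = verts (dbg D \<eta>) t"
      using ball by (rule eventually_mono) (rule d[THEN conjunct1])
    moreover have "\<forall>\<^sub>F s in nhds t. edges (dbg D \<eta>) s = edges (dbg D \<eta>) t"
      using ball by (rule eventually_mono) (rule d[THEN conjunct2])
    ultimately show False using t unfolding crit_def by blast
  qed
qed

lemma dynamic_graph_dbg:
  assumes "dynamic_bayesian_network D"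
  shows "dynamic_graph (dbg D \<eta>)"
proof -
  let ?G = "dbg D \<eta>" and ?h = "time_step D"
  have fin: "finite (vars D)" "vars D \<noteq> {}" and h: "?h > 0"
    and sub: "intra D \<subseteq> vars D \<times> vars D"
    using assms by (auto simp: dynamic_bayesian_network_def)
  have slice: "slice_edges D \<eta> k \<subseteq> {{x, x'} | x x'. x \<in> vars D \<and> x' \<in> vars D}" for k
    using sub unfolding slice_edges_def by blast
  have loop: "{x, x} \<in> slice_edges D \<eta> k" if "x \<in> vars D" for x k
    using that unfolding slice_edges_def by blast
  have verts: "verts ?G t = (if t < 0 then {} else vars D)" for t by (simp add: dbg_def)
  have edges_sub: "edges ?G t \<subseteq> {{x, x'} | x x'. x \<in> verts ?G t \<and> x' \<in> verts ?G t}" for t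
    using slice by (simp add: dbg_def Let_def)
  have loops: "{x, x} \<in> edges ?G t" if "x \<in> verts ?G t" for x t
    using that loop by (auto simp: dbg_def Let_def split: if_splits)
  have tame: "finite (crit ?G \<inter> {a..b})" for a b
  proof (rule finite_subset)
    show "crit ?G \<inter> {a..b} \<subseteq> (\<lambda>k. real k * ?h) ` {..nat \<lceil>b / ?h\<rceil>}"
    proof
      fix t assume "t \<in> crit ?G \<inter> {a..b}"
      then obtain k where k: "t = real k * ?h" "t \<le> b" using dbg_crit[OF h] by fastforce
      then have "real k \<le> b / ?h" using h by (simp add: pos_le_divide_eq)
      then have "k \<le> nat \<lceil>b / ?h\<rceil>" by linarith
      then show "t \<in> (\<lambda>k. real k * ?h) ` {..nat \<lceil>b / ?h\<rceil>}" using k by blast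
    qed
  qed simp
  have life: "lifespan ?G x = {0..}" if "x \<in> vars D" for x
    using that by (auto simp: lifespan_def verts)
  have comp: "\<forall>\<^sub>F \<epsilon> in at_right 0.
        verts ?G (t - \<epsilon>) \<subseteq> verts ?G t \<and> verts ?G (t + \<epsilon>) \<subseteq> verts ?G t \<and>
        edges ?G (t - \<epsilon>) \<subseteq> edges ?G t \<and> edges ?G (t + \<epsilon>) \<subseteq> edges ?G t" for t
  proof (cases "t \<in> range (\<lambda>k. real k * ?h)")
    case False
    then obtain d where "d > 0" and d: "\<And>s. \<bar>s - t\<bar> < d \<Longrightarrow>
        verts ?G s = verts ?G t \<and> edges ?G s = edges ?G t"
      using dbg_local_const[OF h, of t \<eta>] by blast
    have small: "\<forall>\<^sub>F \<epsilon> in at_right 0. 0 < \<epsilon> \<and> \<epsilon> < d"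
      using \<open>d > 0\<close> unfolding eventually_at_right_field by blast
    show ?thesis using small
    proof (rule eventually_mono)
      fix \<epsilon> assume "0 < \<epsilon> \<and> \<epsilon> < d"
      then have "\<bar>(t - \<epsilon>) - t\<bar> < d" "\<bar>(t + \<epsilon>) - t\<bar> < d" by simp_all
      from this[THEN d]
      show "verts ?G (t - \<epsilon>) \<subseteq> verts ?G t \<and> verts ?G (t + \<epsilon>) \<subseteq> verts ?G t \<and>
        edges ?G (t - \<epsilon>) \<subseteq> edges ?G t \<and> edges ?G (t + \<epsilon>) \<subseteq> edges ?G t"
        by blast
    qed
  next
    case True
    then obtain k where t: "t = real k * ?h" by blast
    have t0: "t \<ge> 0" using h t by simp
    have plus: "edges ?G (t + \<epsilon>) = slice_edges D \<eta> k" if "0 < \<epsilon>" "\<epsilon> < ?h" for \<epsilon>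
      using that h by (intro dbg_edges(1)) (simp_all add: t algebra_simps)
    have here: "slice_edges D \<eta> k \<subseteq> edges ?G t"
      using dbg_edges(2)[OF h, of k \<eta>] dbg_edges(3)[OF h, of \<eta>] t by (cases k) auto
    have minus: "edges ?G (t - \<epsilon>) \<subseteq> edges ?G t" if "0 < \<epsilon>" "\<epsilon> < ?h" for \<epsilon>
    proof (cases k)
      case 0
      then show ?thesis using that t by (simp add: dbg_def)
    next
      case (Suc j)
      have "edges ?G (t - \<epsilon>) = slice_edges D \<eta> j"
        using that h by (intro dbg_edges(1)) (simp_all add: t Suc algebra_simps)
      then show ?thesis using dbg_edges(2)[OF h, of k \<eta>] t Suc by auto
    qed
    have small: "\<forall>\<^sub>F \<epsilon> in at_right 0. 0 < \<epsilon> \<and> \<epsilon> < ?h"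
      using h unfolding eventually_at_right_field by blast
    show ?thesis using small
    proof (rule eventually_mono)
      fix \<epsilon> assume e: "0 < \<epsilon> \<and> \<epsilon> < ?h"
      have "verts ?G (t - \<epsilon>) \<subseteq> verts ?G t" "verts ?G (t + \<epsilon>) \<subseteq> verts ?G t"
        using t0 by (simp_all add: verts)
      moreover have "edges ?G (t + \<epsilon>) \<subseteq> edges ?G t" using plus e here by simp
      moreover have "edges ?G (t - \<epsilon>) \<subseteq> edges ?G t" using minus e by simp
      ultimately show "verts ?G (t - \<epsilon>) \<subseteq> verts ?G t \<and> verts ?G (t + \<epsilon>) \<subseteq> verts ?G t \<and>
        edges ?G (t - \<epsilon>) \<subseteq> edges ?G t \<and> edges ?G (t + \<epsilon>) \<subseteq> edges ?G t"
        by blast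
    qed
  qed
  have nodes: "nodes ?G = vars D" by (simp add: dbg_def)
  have verts_sub: "verts ?G t \<subseteq> vars D" for t by (simp add: verts)
  have life': "lifespan ?G x \<noteq> {} \<and> closed (lifespan ?G x) \<and> is_interval (lifespan ?G x)"
    if "x \<in> vars D" for x
    using that by (simp add: life is_interval_ci)
  show ?thesis unfolding dynamic_graph_def nodes
    by (intro conjI allI ballI fin verts_sub edges_sub loops tame comp life'[THEN conjunct1]
        life'[THEN conjunct2, THEN conjunct1] life'[THEN conjunct2, THEN conjunct2])
qed

end

theory Submission
  imports Defs
begin

text \<open>
  The pseudo-metric properties are those of shortest paths, with tripods as paths whose lengths are
  their constants \<open>\<epsilon>\<close>: there are paths of length \<open>0\<close>, every path can be reversed, and paths can be
  concatenated. The identity tripod is a \<open>0\<close>-tripod because smoothing by \<open>0\<close> changes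
  nothing, and a tripod is reversed by exchanging its legs.

  For the triangle inequality, an \<open>\<epsilon>\<close>-tripod between \<open>G\<close> and \<open>H\<close> and a \<open>\<delta>\<close>-tripod between \<open>H\<close>
  and \<open>K\<close> are composed to an \<open>(\<epsilon> + \<delta>)\<close>-tripod between \<open>G\<close> and \<open>K\<close>
  (lemma \<open>eps_tripod_compose\<close>): the apex is the fibre product of the two apexes over the nodes of \<open>H\<close>,
  which still surjects onto the nodes of \<open>G\<close> and of \<open>K\<close>. The constants add up because every inclusion
  into a \<open>\<delta>\<close>-smoothing stays an inclusion when both sides are smoothed by \<open>\<epsilon>\<close> more, as
  \<open>r \<in> [s]\<^sup>\<delta>\<close> and \<open>s \<in> [t]\<^sup>\<epsilon>\<close> imply \<open>r \<in> [t]\<^sup>\<epsilon>\<^sup>+\<^sup>\<delta>\<close>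
  (lemma \<open>subgraph_always_pullback_smoothing\<close>). Taking the infimum over both tripods gives the claim.
\<close>


section \<open>Calculus of pullbacks and smoothings\<close>

lemma subgraph_always_trans:
  "subgraph_always G H \<Longrightarrow> subgraph_always H K \<Longrightarrow> subgraph_always G K"
  unfolding subgraph_always_def by blast

lemma pullback_cong:
  assumes "\<And>z. z \<in> Z \<Longrightarrow> \<phi> z = \<psi> z"
  shows "pullback Z \<phi> G = pullback Z \<psi> G"
proof -
  have "{{z, z'} | z z'. z \<in> Z \<and> z' \<in> Z \<and> {\<phi> z, \<phi> z'} \<in> edges G t}
      = {{z, z'} | z z'. z \<in> Z \<and> z' \<in> Z \<and> {\<psi> z, \<psi> z'} \<in> edges G t}" for t
    by (intro Collect_cong ex_cong1) (simp add: assms cong: conj_cong)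
  moreover have "{z \<in> Z. \<phi> z \<in> verts G t} = {z \<in> Z. \<psi> z \<in> verts G t}" for t
    using assms by auto
  ultimately show ?thesis by (simp only: pullback_def)
qed

lemma subgraph_always_pullback_mono:
  assumes "subgraph_always (pullback Z \<phi> G) (pullback Z \<psi> H)" and "p ` P \<subseteq> Z"
  shows "subgraph_always (pullback P (\<phi> \<circ> p) G) (pullback P (\<psi> \<circ> p) H)"
  using assms unfolding subgraph_always_pullback_iff by (simp add: image_subset_iff)

lemma smoothing_zero: "smoothing 0 G = G"
  by (simp add: smoothing_def)

text \<open>
  A vertex or edge seen by \<open>S\<^sub>\<epsilon> G\<close> at time \<open>t\<close> is present in \<open>G\<close> at some time within \<open>\<epsilon>\<close> of \<open>t\<close>, and
  hence in \<open>H\<close> at some time within \<open>\<delta>\<close> of that one; the two time shifts add up.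
\<close>

lemma subgraph_always_pullback_smoothing:
  assumes "subgraph_always (pullback Z \<phi> G) (pullback Z \<psi> (smoothing \<delta> H))"
  shows "subgraph_always (pullback Z \<phi> (smoothing \<epsilon> G)) (pullback Z \<psi> (smoothing (\<epsilon> + \<delta>) H))"
proof -
  have shift: "{s - \<delta>..s + \<delta>} \<subseteq> {t - (\<epsilon> + \<delta>)..t + (\<epsilon> + \<delta>)}"
    if "s \<in> {t - \<epsilon>..t + \<epsilon>}" for s t
    using that by auto
  have verts_shift: "verts (smoothing \<delta> H) s \<subseteq> verts (smoothing (\<epsilon> + \<delta>) H) t"
    and edges_shift: "edges (smoothing \<delta> H) s \<subseteq> edges (smoothing (\<epsilon> + \<delta>) H) t"
    if "s \<in> {t - \<epsilon>..t + \<epsilon>}" for s t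
    using UN_mono[OF shift[OF that] order_refl] by (simp_all add: smoothing_def)
  show ?thesis
    unfolding subgraph_always_pullback_iff
  proof (intro allI conjI ballI impI)
    fix t z assume "z \<in> Z" "\<phi> z \<in> verts (smoothing \<epsilon> G) t"
    then obtain s where s: "s \<in> {t - \<epsilon>..t + \<epsilon>}" "\<phi> z \<in> verts G s"
      unfolding smoothing_def by auto
    then have "\<psi> z \<in> verts (smoothing \<delta> H) s"
      using assms \<open>z \<in> Z\<close> unfolding subgraph_always_pullback_iff by blast
    then show "\<psi> z \<in> verts (smoothing (\<epsilon> + \<delta>) H) t" using verts_shift s(1) by blast
  next
    fix t z z' assume z: "z \<in> Z" "z' \<in> Z" and "{\<phi> z, \<phi> z'} \<in> edges (smoothing \<epsilon> G) t"
    then obtain s where s: "s \<in> {t - \<epsilon>..t + \<epsilon>}" "{\<phi> z, \<phi> z'} \<in> edges G s"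
      unfolding smoothing_def by auto
    then have "{\<psi> z, \<psi> z'} \<in> edges (smoothing \<delta> H) s"
      using assms z unfolding subgraph_always_pullback_iff by blast
    then show "{\<psi> z, \<psi> z'} \<in> edges (smoothing (\<epsilon> + \<delta>) H) t" using edges_shift s(1) by blast
  qed
qed


section \<open>Reversal and composition of interleavings\<close>

lemma eps_tripod_refl: "eps_tripod 0 (nodes G) (\<lambda>x. x) (\<lambda>x. x) G G"
  by (simp add: eps_tripod_def tripod_def smoothing_zero subgraph_always_def)

lemma eps_tripod_sym: "eps_tripod \<epsilon> Z \<phi> \<psi> G H \<Longrightarrow> eps_tripod \<epsilon> Z \<psi> \<phi> H G"
  by (auto simp: eps_tripod_def tripod_def)

text \<open>
  Half of the composition of two tripods, through the chain \<open>G \<rightarrow> S\<^sub>\<epsilon> H \<rightarrow> S\<^sub>\<epsilon>\<^sub>+\<^sub>\<delta> K\<close>. The apex \<open>P\<close> is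
  given by arbitrary maps \<open>p\<close> and \<open>q\<close> instead of being the fibre product, so that the other half, from
  \<open>K\<close> to \<open>G\<close>, is the instance with the two maps exchanged.
\<close>

lemma subgraph_always_pullback_compose:
  assumes GH: "subgraph_always (pullback Z \<phi> G) (pullback Z \<psi> (smoothing \<epsilon> H))"
    and HK: "subgraph_always (pullback W \<phi>' H) (pullback W \<psi>' (smoothing \<delta> K))"
    and "p ` P \<subseteq> Z" and "q ` P \<subseteq> W" and agree: "\<And>x. x \<in> P \<Longrightarrow> \<psi> (p x) = \<phi>' (q x)"
  shows "subgraph_always (pullback P (\<phi> \<circ> p) G) (pullback P (\<psi>' \<circ> q) (smoothing (\<epsilon> + \<delta>) K))"
proof (rule subgraph_always_trans)
  show "subgraph_always (pullback P (\<phi> \<circ> p) G) (pullback P (\<psi> \<circ> p) (smoothing \<epsilon> H))"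
    using GH \<open>p ` P \<subseteq> Z\<close> by (rule subgraph_always_pullback_mono)
  have "pullback P (\<psi> \<circ> p) (smoothing \<epsilon> H) = pullback P (\<phi>' \<circ> q) (smoothing \<epsilon> H)"
    using agree by (intro pullback_cong) simp
  then show "subgraph_always (pullback P (\<psi> \<circ> p) (smoothing \<epsilon> H))
      (pullback P (\<psi>' \<circ> q) (smoothing (\<epsilon> + \<delta>) K))"
    using subgraph_always_pullback_mono[OF subgraph_always_pullback_smoothing[OF HK] \<open>q ` P \<subseteq> W\<close>]
    by simp
qed

text \<open>
  The fibre product is the right apex: its points are the pairs on which the two tripods agree over
  \<open>H\<close>, and surjectivity of the inner legs \<open>\<psi>\<close> and \<open>\<phi>'\<close> onto the nodes of \<open>H\<close> makes both projections,
  and hence both outer legs, surjective.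
\<close>

lemma eps_tripod_compose:
  assumes GH: "eps_tripod \<epsilon> Z \<phi> \<psi> G H" and HK: "eps_tripod \<delta> W \<phi>' \<psi>' H K"
  shows "eps_tripod (\<epsilon> + \<delta>) {(z, w). z \<in> Z \<and> w \<in> W \<and> \<psi> z = \<phi>' w} (\<phi> \<circ> fst) (\<psi>' \<circ> snd) G K"
proof -
  define P where "P = {(z, w). z \<in> Z \<and> w \<in> W \<and> \<psi> z = \<phi>' w}"
  have legs: "\<phi> ` Z = nodes G" "\<psi> ` Z = nodes H" "\<phi>' ` W = nodes H" "\<psi>' ` W = nodes K"
    using GH HK by (auto simp: eps_tripod_def tripod_def)
  have "\<exists>w. (z, w) \<in> P" if "z \<in> Z" for z
  proof -
    have "\<psi> z \<in> \<phi>' ` W" using that legs(2,3) by blast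
    then show ?thesis using that by (auto simp: P_def)
  qed
  moreover have "\<exists>z. (z, w) \<in> P" if "w \<in> W" for w
  proof -
    have "\<phi>' w \<in> \<psi> ` Z" using that legs(2,3) by blast
    then show ?thesis using that by (auto simp: P_def)
  qed
  ultimately have proj: "fst ` P = Z" "snd ` P = W"
    by (force simp: P_def)+
  have agree: "\<psi> (fst x) = \<phi>' (snd x)" if "x \<in> P" for x
    using that by (auto simp: P_def)
  have "tripod P (\<phi> \<circ> fst) (\<psi>' \<circ> snd) (nodes G) (nodes K)"
    by (simp only: tripod_def image_comp[symmetric] proj legs)
  moreover have "subgraph_always (pullback P (\<phi> \<circ> fst) G)
      (pullback P (\<psi>' \<circ> snd) (smoothing (\<epsilon> + \<delta>) K))"
    using GH HK proj agree unfolding eps_tripod_def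
    by (intro subgraph_always_pullback_compose[of Z \<phi> G \<psi> \<epsilon> H W \<phi>' \<psi>' \<delta>]) auto
  moreover have "subgraph_always (pullback P (\<psi>' \<circ> snd) K)
      (pullback P (\<phi> \<circ> fst) (smoothing (\<delta> + \<epsilon>) G))"
    using GH HK proj agree unfolding eps_tripod_def
    by (intro subgraph_always_pullback_compose[of W \<psi>' K \<phi>' \<delta> H Z \<psi> \<phi> \<epsilon>]) auto
  ultimately show ?thesis
    unfolding eps_tripod_def P_def by (simp add: add.commute)
qed


section \<open>The interleaving distance is an extended pseudo-metric\<close>

lemma interleaving_dist_nonneg: "interleaving_dist G H \<ge> 0"
  unfolding interleaving_dist_def by (rule Inf_greatest) auto

lemma interleaving_dist_le:
  assumes "eps_tripod \<epsilon> Z \<phi> \<psi> G H" and "\<epsilon> \<ge> 0"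
  shows "interleaving_dist G H \<le> ereal \<epsilon>"
  unfolding interleaving_dist_def
  using eps_tripod_any_type[OF assms(1)] assms(2) by (intro Inf_lower) blast

text \<open>
  Only a strict upper bound on the distance produces a tripod, since the infimum is not known to be
  attained.
\<close>

lemma interleaving_dist_lessE:
  fixes G :: "'a dyn_graph" and H :: "'b dyn_graph"
  assumes "interleaving_dist G H < r"
  obtains \<epsilon> and Z :: "('a \<times> 'b) set" and \<phi> \<psi>
  where "\<epsilon> \<ge> 0" "ereal \<epsilon> < r" "eps_tripod \<epsilon> Z \<phi> \<psi> G H"
  using assms unfolding interleaving_dist_def Inf_less_iff by blast

lemma interleaving_dist_self: "interleaving_dist G G = 0"
  using interleaving_dist_le[OF eps_tripod_refl, of G] interleaving_dist_nonneg[of G G]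
  by (simp add: zero_ereal_def)

text \<open>
  A reversed tripod keeps its apex in \<open>'b \<times> 'a\<close>, whereas the distance in the other direction ranges
  over apexes in \<open>'a \<times> 'b\<close>; lemma \<open>interleaving_dist_le\<close>, which accepts an apex of any type, bridges
  this.
\<close>

lemma interleaving_dist_commute: "interleaving_dist G H = interleaving_dist H G"
proof (rule antisym)
  have le: "interleaving_dist G H \<le> interleaving_dist H G"
    for G :: "'x dyn_graph" and H :: "'y dyn_graph"
  proof (rule dense_ge)
    fix r assume "interleaving_dist H G < r"
    then obtain \<epsilon> and Z :: "('y \<times> 'x) set" and \<phi> \<psi>
      where "\<epsilon> \<ge> 0" "ereal \<epsilon> < r" "eps_tripod \<epsilon> Z \<phi> \<psi> H G"
      by (rule interleaving_dist_lessE)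
    then show "interleaving_dist G H \<le> r"
      using interleaving_dist_le[OF eps_tripod_sym] by (meson less_imp_le order_trans)
  qed
  show "interleaving_dist G H \<le> interleaving_dist H G" by (rule le)
  show "interleaving_dist H G \<le> interleaving_dist G H" by (rule le)
qed

lemma interleaving_dist_triangle:
  fixes G :: "'a dyn_graph" and H :: "'b dyn_graph" and K :: "'c dyn_graph"
  shows "interleaving_dist G K \<le> interleaving_dist G H + interleaving_dist H K"
proof (cases "interleaving_dist G H = \<infinity> \<or> interleaving_dist H K = \<infinity>")
  case True
  then show ?thesis by auto
next
  case False
  then obtain a b where ab: "interleaving_dist G H = ereal a" "interleaving_dist H K = ereal b"
    using interleaving_dist_nonneg[of G H] interleaving_dist_nonneg[of H K]
    by (cases "interleaving_dist G H"; cases "interleaving_dist H K") auto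
  show ?thesis
  proof (rule ereal_le_epsilon2)
    \<comment> \<open>Each tripod may miss its infimum by \<open>e / 2\<close>.\<close>
    fix e :: real assume "e > 0"
    then have "interleaving_dist G H < ereal (a + e / 2)"
      and "interleaving_dist H K < ereal (b + e / 2)"
      by (simp_all add: ab)
    then obtain \<epsilon> Z \<phi> \<psi> \<delta> W \<phi>' \<psi>'
      where eps: "\<epsilon> \<ge> 0" "\<epsilon> < a + e / 2" "eps_tripod \<epsilon> (Z :: ('a \<times> 'b) set) \<phi> \<psi> G H"
        and del: "\<delta> \<ge> 0" "\<delta> < b + e / 2" "eps_tripod \<delta> (W :: ('b \<times> 'c) set) \<phi>' \<psi>' H K"
      by (elim interleaving_dist_lessE) simp
    have "interleaving_dist G K \<le> ereal (\<epsilon> + \<delta>)"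
      using eps(1) del(1)
      by (intro interleaving_dist_le[OF eps_tripod_compose[OF eps(3) del(3)]]) simp
    also have "\<dots> \<le> ereal (a + b + e)"
      using eps(2) del(2) by simp
    finally show "interleaving_dist G K
        \<le> interleaving_dist G H + interleaving_dist H K + ereal e"
      by (simp add: ab)
  qed
qed

theorem theorem4p11:
  fixes D\<^sub>X :: "('a, 's) dbn" and D\<^sub>Y :: "('b, 't) dbn" and D\<^sub>W :: "('c, 'u) dbn"
    and \<eta>\<^sub>X \<eta>\<^sub>Y \<eta>\<^sub>W :: real
  assumes "dynamic_bayesian_network D\<^sub>X"
    and "dynamic_bayesian_network D\<^sub>Y"
    and "dynamic_bayesian_network D\<^sub>W"
  shows "interleaving_dist (dbg D\<^sub>X \<eta>\<^sub>X) (dbg D\<^sub>Y \<eta>\<^sub>Y) \<in> {0..\<infinity>}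
    \<and> interleaving_dist (dbg D\<^sub>X \<eta>\<^sub>X) (dbg D\<^sub>X \<eta>\<^sub>X) = 0
    \<and> interleaving_dist (dbg D\<^sub>X \<eta>\<^sub>X) (dbg D\<^sub>Y \<eta>\<^sub>Y) = interleaving_dist (dbg D\<^sub>Y \<eta>\<^sub>Y) (dbg D\<^sub>X \<eta>\<^sub>X)
    \<and> interleaving_dist (dbg D\<^sub>X \<eta>\<^sub>X) (dbg D\<^sub>W \<eta>\<^sub>W)
        \<le> interleaving_dist (dbg D\<^sub>X \<eta>\<^sub>X) (dbg D\<^sub>Y \<eta>\<^sub>Y) + interleaving_dist (dbg D\<^sub>Y \<eta>\<^sub>Y) (dbg D\<^sub>W \<eta>\<^sub>W)"
proof (intro conjI)
  show "interleaving_dist (dbg D\<^sub>X \<eta>\<^sub>X) (dbg D\<^sub>Y \<eta>\<^sub>Y) \<in> {0..\<infinity>}"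
    by (simp add: interleaving_dist_nonneg)
qed (rule interleaving_dist_self interleaving_dist_commute interleaving_dist_triangle)+

end
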